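(* There exists no cost sharing mechanism $(g,f,x)$ which satisfies truthfulness, feasibility, efficiency, and budget balance simultaneously.
   Context: **Cost sharing problem.** Let $V$ be a finite set of nodes, $s\notin V$ a source, and $G=\langle V\cup\{s\},E\rangle$ a connected undirected graph in which each edge $(i,j)\in E$ has a cost $c_{(i,j)}\ge 0$. Each $i\in V$ has a private valuation $v_i\ge 0$. For $i\in V\cup\{s\}$ let $e_i$ be the set of edges adjacent to $i$, and let $\theta_i=(e_i,v_i)$ be the type of $i$ (the valuation of $s$ is null). Each node makes a report $\theta_i'=(e_i',v_i')$ with $e_i'\subseteq e_i$ and $v_i'\ge 0$; the source does not behave strategically. Let $\theta'=(\theta_i')_{i\in V\cup\{s\}}=(\theta_i',\theta_{-i}')$ be the report profile, where $\theta_{-i}'$ is the profile of all nodes except $i$. $\Theta_i$ is the type space of $i$, $\Theta$ the space of all profiles, $\Theta_{-i}$ the space of profiles of all nodes except $i$. The induced graph is $G(\theta')=\langle V\cup\{s\},E(\theta')\rangle$ with $E(\theta')=\{(i,j)\in E : (i,j)\in e_i'\cap e_j'\}$. **Mechanism.** A cost sharing mechanism $(g,f,x)$ consists of $g:\Theta\to 2^V$, $f:\Theta\to 2^E$, $x:\Theta\to\mathbb{R}^{|V|}$, where $g(\theta')\subseteq V$ is the set of selected nodes, $f(\theta')\subseteq E(\theta')$ is a set of edges connecting the selected nodes (to the source), and $x_i(\theta')$ is the cost share of $i$, with $x_i(\theta')=0$ if $i\notin g(\theta')$. A mechanism is a rule for all cost sharing problems, i.e. for every choice of a finite node set $V$,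 a source $s\notin V$, a connected undirected graph $G=\langle V\cup\{s\},E\rangle$ with edge costs $c_{(i,j)}\ge 0$, and private valuations $v_i\ge 0$ ($i\in V$), and it satisfies a property if it does so on every such problem. The utility of $i\in V$ with true valuation $v_i$ is $u_i(\theta')=v_i-x_i(\theta')$ if $i\in g(\theta')$, and $0$ otherwise. **Social welfare.** For $S\subseteq V$, $C(S)$ is the minimum cost of connecting the nodes of $S$ to $s$ in $G(\theta')$, i.e. the weight of a minimum Steiner tree of $S\cup\{s\}$ (a minimum-weight tree containing these nodes, possibly using nodes outside $S\cup\{s\}$); $C(S)=+\infty$ if no such tree exists. $SW(S)=\sum_{i\in S}v_i'-C(S)$. **Properties.** - Truthfulness: $u_i((\theta_i,\theta_{-i}'))\ge u_i((\theta_i',\theta_{-i}'))$ for all $i\in V$, all (true types) $\theta_i\in\Theta_i$, all reports $\theta_i'\in\Theta_i$ (with $e_i'\subseteq e_i$), and all $\theta_{-i}'\in\Theta_{-i}$, where both utilities are evaluated with the true valuation $v_i$. - Feasibility: $x_i(\theta')\le v_i'$ for all $i\in V$, $\theta'\in\Theta$. - Efficiency: $SW(g(\theta'))=\max_{S\subseteq V}SW(S)$ for all $\theta'\in\Theta$. - Budget balance: $\sum_{i\in V}x_i(\theta')=\sum_{(i,j)\in f(\theta')}c_{(i,j)}$ for all $\theta'\in\Theta$. *)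

theory Defs
  imports
    Complex_Main
    "HOL-Library.FuncSet"
    "HOL-Library.Extended_Real"
    "HOL-Library.Infinite_Typeclass"
begin

section \<open>Undirected graphs\<close>

text \<open>The edge between \<open>i\<close> and \<open>j\<close> is the two-element set \<open>{i, j}\<close>.\<close>

definition graph :: "'a set \<Rightarrow> 'a set set \<Rightarrow> bool" where
  "graph W F \<longleftrightarrow> (\<forall>e\<in>F. \<exists>i\<in>W. \<exists>j\<in>W. i \<noteq> j \<and> e = {i, j})"

definition joined :: "'a set set \<Rightarrow> 'a \<Rightarrow> 'a \<Rightarrow> bool" where
  "joined F i j \<longleftrightarrow> (i, j) \<in> {(k, l). {k, l} \<in> F}\<^sup>*"

definition connected_graph :: "'a set \<Rightarrow> 'a set set \<Rightarrow> bool" where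
  "connected_graph W F \<longleftrightarrow> graph W F \<and> W \<noteq> {} \<and> (\<forall>i\<in>W. \<forall>j\<in>W. joined F i j)"

definition cycle :: "'a set set \<Rightarrow> 'a list \<Rightarrow> bool" where
  "cycle F p \<longleftrightarrow> 3 \<le> length p \<and> distinct p \<and>
     (\<forall>k<length p. {p ! k, p ! (Suc k mod length p)} \<in> F)"

definition tree :: "'a set \<Rightarrow> 'a set set \<Rightarrow> bool" where
  "tree W F \<longleftrightarrow> connected_graph W F \<and> (\<nexists>p. cycle F p)"

section \<open>Cost sharing problems\<close>

text \<open>
  The private valuations are not a field of this record: they are part of the types below,
  and truthfulness quantifies over all of them. In particular a mechanism, which is a function of a
  network and a report profile, learns about valuations only through the reports.
  Node sets of every finite size are available only if \<open>'a\<close> is infinite.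
\<close>

record 'a network =
  nodes :: "'a set"
  source :: 'a
  edges :: "'a set set"
  cost :: "'a set \<Rightarrow> real"

definition vertices :: "'a network \<Rightarrow> 'a set" where
  "vertices N = nodes N \<union> {source N}"

definition cost_sharing_network :: "'a network \<Rightarrow> bool" where
  "cost_sharing_network N \<longleftrightarrow>
     finite (nodes N) \<and> source N \<notin> nodes N \<and>
     connected_graph (vertices N) (edges N) \<and> (\<forall>e\<in>edges N. 0 \<le> cost N e)"

definition adjacent_edges :: "'a network \<Rightarrow> 'a \<Rightarrow> 'a set set" where
  "adjacent_edges N i = {e \<in> edges N. i \<in> e}"

type_synonym 'a type = "'a set set \<times> real"
type_synonym 'a profile = "'a \<Rightarrow> 'a type"

text \<open>
  The source does not behave strategically: its only type is its full set of adjacent edges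
  together with the null valuation.
\<close>

definition type_space :: "'a network \<Rightarrow> 'a \<Rightarrow> 'a type set" where
  "type_space N i =
     (if i = source N then {(adjacent_edges N i, 0)}
      else {(e, v). e \<subseteq> adjacent_edges N i \<and> 0 \<le> v})"

definition profiles :: "'a network \<Rightarrow> 'a profile set" where
  "profiles N = (\<Pi>\<^sub>E i\<in>vertices N. type_space N i)"

text \<open>
  For \<open>\<theta>\<close> in the following space, \<open>\<theta>(i := t)\<close> is the profile in which
  \<open>i\<close> has type \<open>t\<close> and the others are as in \<open>\<theta>\<close>.
\<close>

definition profiles_except :: "'a network \<Rightarrow> 'a \<Rightarrow> 'a profile set" where
  "profiles_except N i = (\<Pi>\<^sub>E j\<in>vertices N - {i}. type_space N j)"

definition induced_edges :: "'a network \<Rightarrow> 'a profile \<Rightarrow> 'a set set" where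
  "induced_edges N \<theta> = {e \<in> edges N. \<forall>i\<in>e. e \<in> fst (\<theta> i)}"

section \<open>Social welfare\<close>

definition steiner_trees :: "'a network \<Rightarrow> 'a profile \<Rightarrow> 'a set \<Rightarrow> 'a set set set" where
  "steiner_trees N \<theta> S =
     {F. F \<subseteq> induced_edges N \<theta> \<and>
         (\<exists>W. S \<union> {source N} \<subseteq> W \<and> W \<subseteq> vertices N \<and> tree W F)}"

definition connection_cost :: "'a network \<Rightarrow> 'a profile \<Rightarrow> 'a set \<Rightarrow> ereal" where
  "connection_cost N \<theta> S =
     (if steiner_trees N \<theta> S = {} then \<infinity>
      else ereal (Min ((\<lambda>F. \<Sum>e\<in>F. cost N e) ` steiner_trees N \<theta> S)))"

definition social_welfare :: "'a network \<Rightarrow> 'a profile \<Rightarrow> 'a set \<Rightarrow> ereal" where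
  "social_welfare N \<theta> S = ereal (\<Sum>i\<in>S. snd (\<theta> i)) - connection_cost N \<theta> S"

section \<open>Mechanisms on a network and their properties\<close>

definition cost_sharing_mechanism ::
  "'a network \<Rightarrow> ('a profile \<Rightarrow> 'a set) \<Rightarrow> ('a profile \<Rightarrow> 'a set set) \<Rightarrow>
   ('a profile \<Rightarrow> 'a \<Rightarrow> real) \<Rightarrow> bool" where
  "cost_sharing_mechanism N g f x \<longleftrightarrow>
     (\<forall>\<theta>\<in>profiles N.
        g \<theta> \<subseteq> nodes N \<and>
        f \<theta> \<subseteq> induced_edges N \<theta> \<and>
        (\<forall>i\<in>g \<theta>. joined (f \<theta>) i (source N)) \<and>
        (\<forall>i\<in>nodes N - g \<theta>. x \<theta> i = 0))"

text \<open>The argument \<open>v\<close> is the true valuation of \<open>i\<close>; \<open>\<theta>\<close> is the reported profile.\<close>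

definition utility ::
  "('a profile \<Rightarrow> 'a set) \<Rightarrow> ('a profile \<Rightarrow> 'a \<Rightarrow> real) \<Rightarrow> 'a \<Rightarrow> real \<Rightarrow> 'a profile \<Rightarrow> real" where
  "utility g x i v \<theta> = (if i \<in> g \<theta> then v - x \<theta> i else 0)"

definition truthful ::
  "'a network \<Rightarrow> ('a profile \<Rightarrow> 'a set) \<Rightarrow> ('a profile \<Rightarrow> 'a \<Rightarrow> real) \<Rightarrow> bool" where
  "truthful N g x \<longleftrightarrow>
     (\<forall>i\<in>nodes N. \<forall>t\<in>type_space N i. \<forall>r\<in>type_space N i. \<forall>\<theta>\<in>profiles_except N i.
        fst r \<subseteq> fst t \<longrightarrow>
        utility g x i (snd t) (\<theta>(i := t)) \<ge> utility g x i (snd t) (\<theta>(i := r)))"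

definition feasible :: "'a network \<Rightarrow> ('a profile \<Rightarrow> 'a \<Rightarrow> real) \<Rightarrow> bool" where
  "feasible N x \<longleftrightarrow> (\<forall>i\<in>nodes N. \<forall>\<theta>\<in>profiles N. x \<theta> i \<le> snd (\<theta> i))"

definition efficient :: "'a network \<Rightarrow> ('a profile \<Rightarrow> 'a set) \<Rightarrow> bool" where
  "efficient N g \<longleftrightarrow>
     (\<forall>\<theta>\<in>profiles N.
        social_welfare N \<theta> (g \<theta>) = Max (social_welfare N \<theta> ` Pow (nodes N)))"

definition budget_balanced ::
  "'a network \<Rightarrow> ('a profile \<Rightarrow> 'a set set) \<Rightarrow> ('a profile \<Rightarrow> 'a \<Rightarrow> real) \<Rightarrow> bool" where
  "budget_balanced N f x \<longleftrightarrow>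
     (\<forall>\<theta>\<in>profiles N. (\<Sum>i\<in>nodes N. x \<theta> i) = (\<Sum>e\<in>f \<theta>. cost N e))"

end

theory Submission
  imports Defs
begin

text \<open>
  Let \<open>a\<close> be joined to the source by an edge of cost 1 and to \<open>b\<close> by an edge of cost 0.
  If one of the two nodes reports the valuation 2 and the other one a small \<open>w > 0\<close>, then the
  only efficient choice is to select both, and by feasibility the second node pays at most \<open>w\<close>.
  When both valuations are 2, each node could report \<open>w\<close> instead, so by truthfulness each of them
  pays at most \<open>w\<close>; for \<open>w < 1/2\<close> the payments do not cover the edge of cost 1.
\<close>

text \<open>No node hides an edge here, so only the valuations vary. The restriction to
  \<open>vertices N\<close> makes the profile extensional, as membership in
  \<open>profiles N\<close> demands.\<close>

definition full_profile :: "'a network \<Rightarrow> ('a \<Rightarrow> real) \<Rightarrow> 'a profile" where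
  "full_profile N v = (\<lambda>i\<in>vertices N. (adjacent_edges N i, v i))"

lemma full_profile_in_profiles:
  assumes "\<And>i. i \<in> nodes N \<Longrightarrow> 0 \<le> v i" and "v (source N) = 0"
  shows "full_profile N v \<in> profiles N"
  using assms by (auto simp: profiles_def full_profile_def type_space_def vertices_def)

lemma snd_full_profile: "i \<in> vertices N \<Longrightarrow> snd (full_profile N v i) = v i"
  by (simp add: full_profile_def)

lemma induced_edges_full_profile:
  assumes "graph (vertices N) (edges N)"
  shows "induced_edges N (full_profile N v) = edges N"
proof -
  have "e \<subseteq> vertices N" if "e \<in> edges N" for e
    using assms that by (auto simp: graph_def)
  then show ?thesis
    by (auto simp: induced_edges_def full_profile_def adjacent_edges_def)
qed

text \<open>If the true valuation is \<open>v i\<close>, then reporting \<open>w\<close> would be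
  rewarded with at least \<open>v i - w > 0\<close>, because feasibility caps the share at the
  reported \<open>w\<close>. The truthful report must yield at least as much.\<close>

lemma truthful_feasible_share_le:
  assumes truth: "truthful N g x" and feas: "feasible N x"
    and source: "source N \<notin> nodes N" "v (source N) = 0"
    and v: "\<And>j. j \<in> nodes N \<Longrightarrow> 0 \<le> v j"
    and i: "i \<in> nodes N" and w: "0 \<le> w" "w < v i"
    and selected: "i \<in> g (full_profile N (v(i := w)))"
  shows "x (full_profile N v) i \<le> w"
    and "i \<in> g (full_profile N v)"
proof -
  let ?\<theta> = "full_profile N v" and ?\<theta>' = "full_profile N (v(i := w))"
  define \<eta> where "\<eta> = restrict ?\<theta> (vertices N - {i})"
  have iV: "i \<in> vertices N" and ne: "i \<noteq> source N"
    using i source by (auto simp: vertices_def)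
  have "?\<theta> \<in> profiles N"
    using v source by (intro full_profile_in_profiles)
  then have "\<eta> \<in> profiles_except N i"
    by (auto simp: \<eta>_def profiles_def profiles_except_def)
  moreover have "(adjacent_edges N i, v i) \<in> type_space N i"
    and "(adjacent_edges N i, w) \<in> type_space N i"
    using v i w ne by (auto simp: type_space_def)
  moreover have "\<eta>(i := (adjacent_edges N i, v i)) = ?\<theta>"
    and "\<eta>(i := (adjacent_edges N i, w)) = ?\<theta>'"
    using iV by (auto simp: \<eta>_def full_profile_def fun_eq_iff)
  ultimately have util: "utility g x i (v i) ?\<theta> \<ge> utility g x i (v i) ?\<theta>'"
    using truth[unfolded truthful_def, rule_format, OF i, of "(adjacent_edges N i, v i)"
        "(adjacent_edges N i, w)" \<eta>] by simp
  have "?\<theta>' \<in> profiles N"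
    using v source w ne by (intro full_profile_in_profiles) auto
  then have "x ?\<theta>' i \<le> w"
    using feas[unfolded feasible_def, rule_format, OF i, of ?\<theta>'] iV
    by (simp add: snd_full_profile)
  \<comment> \<open>As \<open>w < v i\<close> is strict, the truthful utility is positive, which
    rules out the default utility 0 of an unselected node.\<close>
  with util w selected show "x ?\<theta> i \<le> w" and "i \<in> g ?\<theta>"
    by (auto simp: utility_def split: if_splits)
qed

text \<open>A vertex lies on at most two edges of a cycle, so the center \<open>c\<close> cannot lie
  on three consecutive ones.\<close>

lemma no_cycle_in_star:
  assumes "\<And>e. e \<in> F \<Longrightarrow> c \<in> e"
  shows "\<not> cycle F p"
proof
  assume "cycle F p"
  then have len: "3 \<le> length p" and dist: "distinct p"
    and edge: "\<And>k. k < length p \<Longrightarrow> {p ! k, p ! (Suc k mod length p)} \<in> F"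
    by (auto simp: cycle_def)
  have "p \<noteq> []"
    using len by auto
  \<comment> \<open>The third edge returns to \<open>p ! 0\<close> if the cycle is a triangle and
    goes on to \<open>p ! 3\<close> otherwise.\<close>
  let ?m = "3 mod length p"
  have m: "?m < length p" "?m = 0 \<or> ?m = 3"
    using len by (auto simp: le_less)
  have "c \<in> {p ! 0, p ! 1}" "c \<in> {p ! 1, p ! 2}" "c \<in> {p ! 2, p ! ?m}"
    using assms[OF edge, of 0] assms[OF edge, of 1] assms[OF edge, of 2] len \<open>p \<noteq> []\<close>
    by (simp_all add: numeral_eq_Suc)
  moreover have "p ! 0 \<noteq> p ! 1" "p ! 0 \<noteq> p ! 2" "p ! 1 \<noteq> p ! 2" "p ! 1 \<noteq> p ! ?m" "p ! 2 \<noteq> p ! ?m"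
    using len m \<open>p \<noteq> []\<close> by (auto simp: nth_eq_iff_index_eq[OF dist])
  ultimately show False
    by auto
qed

lemma joinedE_edge_at:
  assumes "joined F i j" and "i \<noteq> j"
  obtains k where "{k, j} \<in> F"
  using assms unfolding joined_def by (auto elim: rtranclE)

lemma finite_steiner_trees:
  "finite (edges N) \<Longrightarrow> finite (steiner_trees N \<theta> S)"
  by (rule finite_subset[of _ "Pow (edges N)"]) (auto simp: steiner_trees_def induced_edges_def)

lemma connection_cost_le:
  assumes "finite (edges N)" and "F \<in> steiner_trees N \<theta> S"
  shows "connection_cost N \<theta> S \<le> ereal (\<Sum>e\<in>F. cost N e)"
  using assms finite_steiner_trees[of N \<theta> S] by (auto simp: connection_cost_def)

text \<open>This includes the case without Steiner trees, where the cost is infinite.\<close>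

lemma connection_cost_ge:
  assumes "finite (edges N)"
    and "\<And>F. F \<in> steiner_trees N \<theta> S \<Longrightarrow> c \<le> (\<Sum>e\<in>F. cost N e)"
  shows "ereal c \<le> connection_cost N \<theta> S"
  using assms finite_steiner_trees[of N \<theta> S] by (auto simp: connection_cost_def)

text \<open>The node \<open>b\<close> reaches the source only through \<open>a\<close>, along a free
  edge, so connecting one node costs as much as connecting both.\<close>

definition relay_network :: "'a \<Rightarrow> 'a \<Rightarrow> 'a \<Rightarrow> 'a network" where
  "relay_network s a b =
     \<lparr>nodes = {a, b}, source = s, edges = {{a, s}, {a, b}},
      cost = (\<lambda>e. if e = {a, s} then 1 else 0)\<rparr>"

lemma relay_network_simps [simp]:
  "nodes (relay_network s a b) = {a, b}"
  "source (relay_network s a b) = s"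
  "edges (relay_network s a b) = {{a, s}, {a, b}}"
  "cost (relay_network s a b) = (\<lambda>e. if e = {a, s} then 1 else 0)"
  "vertices (relay_network s a b) = {s, a, b}"
  by (auto simp: relay_network_def vertices_def)

context
  fixes s a b :: 'a
  assumes distinct: "s \<noteq> a" "s \<noteq> b" "a \<noteq> b"
begin

private abbreviation "N \<equiv> relay_network s a b"

lemma connected_graph_relay: "connected_graph {s, a, b} {{a, s}, {a, b}}"
proof -
  let ?R = "{(k, l). {k, l} \<in> {{a, s}, {a, b}}}"
  have hub: "(a, i) \<in> ?R\<^sup>*" "(i, a) \<in> ?R\<^sup>*" if "i \<in> {s, a, b}" for i
    using that by (auto simp: insert_commute)
  have "(i, j) \<in> ?R\<^sup>*" if "i \<in> {s, a, b}" "j \<in> {s, a, b}" for i j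
    using hub(2)[OF that(1)] hub(1)[OF that(2)] by (rule rtrancl_trans)
  moreover have "graph {s, a, b} {{a, s}, {a, b}}"
    using distinct unfolding graph_def by blast
  ultimately show ?thesis
    by (simp add: connected_graph_def joined_def)
qed

lemma cost_sharing_relay_network: "cost_sharing_network N"
  using distinct connected_graph_relay by (simp add: cost_sharing_network_def)

lemma induced_edges_relay: "induced_edges N (full_profile N v) = {{a, s}, {a, b}}"
  using connected_graph_relay by (simp add: induced_edges_full_profile connected_graph_def)

text \<open>A path to \<open>s\<close> must end with \<open>{a, s}\<close>, the only edge at
  \<open>s\<close>, and the other edge is free. This serves both for Steiner trees and for the edges
  that a mechanism returns.\<close>

lemma relay_cost_joined:
  assumes "F \<subseteq> {{a, s}, {a, b}}" and "joined F i s" and "i \<noteq> s"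
  shows "(\<Sum>e\<in>F. cost N e) = 1"
proof -
  obtain k where "{k, s} \<in> F"
    using assms by (elim joinedE_edge_at)
  then have "{a, s} \<in> F"
    using assms(1) distinct by (auto simp: doubleton_eq_iff)
  moreover have "finite F"
    using assms(1) by (rule finite_subset) simp
  ultimately show ?thesis
    by simp
qed

lemma connection_cost_relay_le: "connection_cost N (full_profile N v) {a, b} \<le> 1"
proof -
  have "\<not> cycle {{a, s}, {a, b}} p" for p
    by (rule no_cycle_in_star[of _ a]) auto
  then have "tree {s, a, b} {{a, s}, {a, b}}"
    using connected_graph_relay by (simp add: tree_def)
  then have "{{a, s}, {a, b}} \<in> steiner_trees N (full_profile N v) {a, b}"
    unfolding steiner_trees_def induced_edges_relay by (intro CollectI conjI exI) auto
  then have "connection_cost N (full_profile N v) {a, b}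
      \<le> ereal (\<Sum>e\<in>{{a, s}, {a, b}}. cost N e)"
    by (intro connection_cost_le) auto
  also have "(\<Sum>e\<in>{{a, s}, {a, b}}. cost N e) = 1"
    using distinct by (auto simp: doubleton_eq_iff)
  finally show ?thesis
    by (simp add: one_ereal_def)
qed

lemma connection_cost_relay_ge:
  assumes "i \<in> S" and "i \<noteq> s"
  shows "1 \<le> connection_cost N (full_profile N v) S"
proof -
  have "1 \<le> (\<Sum>e\<in>F. cost N e)" if "F \<in> steiner_trees N (full_profile N v) S" for F
  proof -
    from that obtain W where "F \<subseteq> {{a, s}, {a, b}}" "S \<union> {s} \<subseteq> W" "tree W F"
      by (auto simp: steiner_trees_def induced_edges_relay)
    moreover from this have "joined F i s"
      using assms by (auto simp: tree_def connected_graph_def)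
    ultimately show ?thesis
      using relay_cost_joined assms by (metis order_refl)
  qed
  then show ?thesis
    using connection_cost_ge[of N "full_profile N v" S 1] by (simp add: one_ereal_def)
qed

text \<open>Selecting both nodes gives welfare at least \<open>v a + v b - 1\<close>. The empty set
  gives at most 0, and a single node bears the same cost 1 while the positive valuation of the other
  is lost.\<close>

lemma efficient_relay_selects_all:
  assumes eff: "efficient N g"
    and g: "g (full_profile N v) \<subseteq> {a, b}"
    and v: "0 < v a" "0 < v b" "1 < v a + v b" "v s = 0"
  shows "g (full_profile N v) = {a, b}"
proof (rule ccontr)
  let ?\<theta> = "full_profile N v"
  let ?S = "g ?\<theta>"
  assume ne: "?S \<noteq> {a, b}"
  have "?\<theta> \<in> profiles N"
    using v by (intro full_profile_in_profiles) auto
  then have "social_welfare N ?\<theta> ?S = Max (social_welfare N ?\<theta> ` Pow (nodes N))"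
    using eff unfolding efficient_def by blast
  then have max: "social_welfare N ?\<theta> {a, b} \<le> social_welfare N ?\<theta> ?S"
    by simp
  have "ereal (v a + v b) - 1 \<le> social_welfare N ?\<theta> {a, b}"
    using distinct connection_cost_relay_le[of v]
    by (auto simp: social_welfare_def snd_full_profile intro!: ereal_minus_mono)
  with max have le: "ereal (v a + v b) - 1 \<le> social_welfare N ?\<theta> ?S"
    by simp
  consider "?S = {}" | i where "?S = {i}" "i \<in> {a, b}"
    using g ne by blast
  then show False
  proof cases
    case 1
    have "ereal 0 \<le> connection_cost N ?\<theta> {}"
      by (rule connection_cost_ge) (auto intro!: sum_nonneg)
    then have "social_welfare N ?\<theta> {} \<le> 0"
      by (simp add: social_welfare_def zero_ereal_def[symmetric])
    with le 1 have "ereal (v a + v b) - 1 \<le> 0"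
      by simp
    then show False
      using v by (simp add: one_ereal_def zero_ereal_def)
  next
    case 2
    then have "social_welfare N ?\<theta> {i} \<le> ereal (v i) - 1"
      using distinct connection_cost_relay_ge[of i "{i}" v]
      by (auto simp: social_welfare_def snd_full_profile intro!: ereal_minus_mono)
    with le 2 have "ereal (v a + v b) - 1 \<le> ereal (v i) - 1"
      by simp
    then show False
      using v 2 by (auto simp: one_ereal_def)
  qed
qed

lemma no_mechanism_on_relay_network:
  assumes mech: "cost_sharing_mechanism N g f x"
    and truth: "truthful N g x" and feas: "feasible N x"
    and eff: "efficient N g" and budget: "budget_balanced N f x"
  shows False
proof -
  define v where "v = (\<lambda>i. if i = s then 0 else 2 :: real)"
  let ?\<theta> = "full_profile N v"
  have share: "x ?\<theta> i \<le> 1/4" "i \<in> g ?\<theta>" if i: "i \<in> {a, b}" for i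
  proof -
    \<comment> \<open>The low report is positive, so that \<open>i\<close> is still selected, and
      below 1/2, so that two such shares cannot cover the cost 1.\<close>
    let ?v = "v(i := 1/4)"
    have "full_profile N ?v \<in> profiles N"
      using i distinct by (intro full_profile_in_profiles) (auto simp: v_def)
    then have "g (full_profile N ?v) \<subseteq> {a, b}"
      using mech by (simp add: cost_sharing_mechanism_def)
    then have "g (full_profile N ?v) = {a, b}"
      using i distinct by (intro efficient_relay_selects_all[OF eff]) (auto simp: v_def)
    then have "i \<in> g (full_profile N ?v)"
      using i by simp
    then show "x ?\<theta> i \<le> 1/4" "i \<in> g ?\<theta>"
      using i distinct
      by (intro truthful_feasible_share_le[OF truth feas, of v i]; force simp: v_def)+
  qed
  have prof: "?\<theta> \<in> profiles N"
    by (intro full_profile_in_profiles) (auto simp: v_def)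
  then have "f ?\<theta> \<subseteq> induced_edges N ?\<theta>" "joined (f ?\<theta>) a s"
    using mech share(2)[of a] by (simp_all add: cost_sharing_mechanism_def)
  \<comment> \<open>Since \<open>a\<close> is selected, the chosen edges join it to the source and
    cost exactly 1, whereas the shares add up to at most 1/2.\<close>
  then have "(\<Sum>e\<in>f ?\<theta>. cost N e) = 1"
    using distinct by (intro relay_cost_joined[of _ a]) (simp_all add: induced_edges_relay)
  then have "x ?\<theta> a + x ?\<theta> b = 1"
    using budget prof distinct by (simp add: budget_balanced_def)
  then show False
    using share(1)[of a] share(1)[of b] by simp
qed

end

theorem proposition4p3:
  shows "\<not> (\<exists>(g :: 'a::infinite network \<Rightarrow> 'a profile \<Rightarrow> 'a set)
             (f :: 'a network \<Rightarrow> 'a profile \<Rightarrow> 'a set set)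
             (x :: 'a network \<Rightarrow> 'a profile \<Rightarrow> 'a \<Rightarrow> real).
           \<forall>N. cost_sharing_network N \<longrightarrow>
             cost_sharing_mechanism N (g N) (f N) (x N) \<and>
             truthful N (g N) (x N) \<and>
             feasible N (x N) \<and>
             efficient N (g N) \<and>
             budget_balanced N (f N) (x N))"
proof -
  \<comment> \<open>An infinite type has three distinct elements, which become the source and the
    two nodes of the counterexample.\<close>
  obtain s :: 'a where True
    by simp
  obtain a where "a \<notin> {s}"
    using ex_new_if_finite[OF infinite_UNIV, of "{s}"] by auto
  moreover obtain b where "b \<notin> {s, a}"
    using ex_new_if_finite[OF infinite_UNIV, of "{s, a}"] by auto
  ultimately have "s \<noteq> a" "s \<noteq> b" "a \<noteq> b"
    by auto
  note cost_sharing_relay_network[OF this] no_mechanism_on_relay_network[OF this]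
  then show ?thesis
    by blast
qed

end
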